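(* Let $(\Omega_i,\mu_i,d_i)$, $i=1,2$, be two metric measure spaces satisfying the standing assumptions, with isoperimetric profiles $I_1,I_2$, such that $\mu_1(\Omega_1)=\mu_2(\Omega_2)$ and $I_1\ge I_2$ pointwise. Then there is a constant $C$ such that for every $w:\Omega_1\to\mathbb{R}_+$ with $w>0$ a.e. and $\frac1w\in M(\Phi_2)(\Omega_1,\mu_1)$, $$\|f\|_{L^1(\Omega_1,\mu_1)}\le C\,\Big\|\frac1w\Big\|_{M(\Phi_2)}^{1/2}\big\||\nabla f|\big\|_{L^1(\Omega_1,\mu_1)}^{1/2}\|wf\|_{L^1(\Omega_1,\mu_1)}^{1/2}$$ for all $f\in Lip(\Omega_1)$ such that $m(f)=0$ (that is, $0$ is a median of $f$) or $\int_{\Omega_1}f\,d\mu_1=0$, if $\mu_1(\Omega_1)<\infty$; respectively for all $f\in Lip_0(\Omega_1)$, if $\mu_1(\Omega_1)=\infty$.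
   Context: Setting and standing assumptions, for each space $(\Omega,\mu,d)$. $(\Omega,\mu,d)$ is a connected metric space with a Borel measure $\mu$ such that $\mu(K)<\infty$ for every compact $K\subset\Omega$. $Lip(\Omega)$ is the set of real-valued Lipschitz functions on $\Omega$ and $Lip_0(\Omega)$ the set of those with compact support. For $f\in Lip(\Omega)$, $|\nabla f(x)|=\limsup_{d(x,y)\to0}\frac{|f(x)-f(y)|}{d(x,y)}$. For a Borel set $A\subset\Omega$, $\mu^+(A)=\liminf_{h\to0}\frac{\mu(A_h)-\mu(A)}{h}$, where $A_h=\{x\in\Omega:d(x,A)<h\}$. The isoperimetric profile is $I:[0,\mu(\Omega))\to\mathbb{R}_+$, $I(t)=\inf\{\mu^+(A):\mu(A)=t\}$. It is assumed that $I$ is concave, continuous and $I(0)=0$; when $\mu(\Omega)<\infty$, that $I$ is symmetric around $\mu(\Omega)/2$ (so increasing on $(0,\mu(\Omega)/2)$ and decreasing on $(\mu(\Omega)/2,\mu(\Omega))$); when $\mu(\Omega)=\infty$, that $I$ is increasing. It is understood that $I>0$ on $(0,\mu(\Omega))$. Median (finite measure). A real number $m(f)$ is a median of an integrable $f$ if $\mu\{f\ge m(f)\}\ge\mu(\Omega)/2$ and $\mu\{f\le m(f)\}\ge\mu(\Omega)/2$. Marcinkiewicz space. Let $L=\mu_1(\Omega_1)=\mu_2(\Omega_2)$. $\Phi_2(t)=\frac{\min\{t,L/2\}}{I_2(\min\{t,L/2\})}$ for $t\in(0,L)$ (so $\Phi_2(t)=t/I_2(t)$ when $L=\infty$), read as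 $0$ at $t=0$ and as its limit at $t=L$. $M(\Phi_2)(\Omega_1,\mu_1)$ consists of the measurable $h$ on $\Omega_1$ with $\|h\|_{M(\Phi_2)}=\sup_{t>0}t\,\Phi_2(\mu_1\{|h|>t\})<\infty$. *)

theory Defs
  imports "HOL-Analysis.Analysis"
begin

definition Lip :: "('a::metric_space \<Rightarrow> real) set" where
  "Lip = {f. \<exists>K. K-lipschitz_on UNIV f}"

definition Lip0 :: "('a::metric_space \<Rightarrow> real) set" where
  "Lip0 = {f \<in> Lip. compact (closure {x. f x \<noteq> 0})}"

text \<open>The limit superior is over the punctured filter \<^term>\<open>at x\<close>; at an isolated point it is 0.\<close>

definition grad_modulus :: "('a::metric_space \<Rightarrow> real) \<Rightarrow> 'a \<Rightarrow> ennreal" where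
  "grad_modulus f x = Limsup (at x) (\<lambda>y. ennreal (\<bar>f x - f y\<bar> / dist x y))"

text \<open>For nonempty \<^term>\<open>A\<close> this is the set of points with \<^term>\<open>infdist x A < h\<close>. The distance
  to the empty set has to be infinite, whereas \<^term>\<open>infdist x {} = 0\<close>.\<close>

definition enlargement :: "'a::metric_space set \<Rightarrow> real \<Rightarrow> 'a set" where
  "enlargement A h = {x. \<exists>a\<in>A. dist x a < h}"

definition outer_minkowski :: "'a::metric_space measure \<Rightarrow> 'a set \<Rightarrow> ennreal" where
  "outer_minkowski M A =
     Liminf (at_right 0) (\<lambda>h. (emeasure M (enlargement A h) - emeasure M A) / ennreal h)"

definition iso_profile :: "'a::metric_space measure \<Rightarrow> ennreal \<Rightarrow> ennreal" where
  "iso_profile M t = (INF A \<in> {A \<in> sets M. emeasure M A = t}. outer_minkowski M A)"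

text \<open>The profile is a real-valued function on \<open>[0, \<mu>(\<Omega>))\<close>, so finiteness there is part of the
  assumptions; concavity and continuity are stated for the resulting real function. Monotonicity
  on the two halves of \<open>(0, \<mu>(\<Omega>))\<close> for finite \<open>\<mu>(\<Omega>)\<close> follows from concavity and symmetry.\<close>

locale isoperimetric_space =
  fixes M :: "'a::metric_space measure"
  assumes connected_space: "connected (UNIV :: 'a set)"
    and borel_measure: "sets M = sets borel"
    and finite_on_compact: "\<And>K. compact K \<Longrightarrow> emeasure M K < \<infinity>"
    and profile_finite: "\<And>t. t < emeasure M (space M) \<Longrightarrow> iso_profile M t < \<infinity>"
    and profile_zero: "iso_profile M 0 = 0"
    and profile_pos: "\<And>t. 0 < t \<Longrightarrow> t < emeasure M (space M) \<Longrightarrow> 0 < iso_profile M t"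
    and profile_concave:
      "concave_on {t. 0 \<le> t \<and> ennreal t < emeasure M (space M)}
         (\<lambda>t. enn2real (iso_profile M (ennreal t)))"
    and profile_continuous:
      "continuous_on {t. 0 \<le> t \<and> ennreal t < emeasure M (space M)}
         (\<lambda>t. enn2real (iso_profile M (ennreal t)))"
    and profile_symmetric:
      "\<And>t. emeasure M (space M) < \<infinity> \<Longrightarrow> 0 < t \<Longrightarrow> t < emeasure M (space M) \<Longrightarrow>
         iso_profile M (emeasure M (space M) - t) = iso_profile M t"
    and profile_increasing:
      "emeasure M (space M) = \<infinity> \<Longrightarrow> mono_on {t. t < \<infinity>} (iso_profile M)"

definition is_median :: "'a measure \<Rightarrow> ('a \<Rightarrow> real) \<Rightarrow> real \<Rightarrow> bool" where
  "is_median M f m \<longleftrightarrow> integrable M f \<and>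
     emeasure M (space M) / 2 \<le> emeasure M {x \<in> space M. m \<le> f x} \<and>
     emeasure M (space M) / 2 \<le> emeasure M {x \<in> space M. f x \<le> m}"

text \<open>If \<open>\<mu>(\<Omega>) = \<infinity>\<close> then the minimum below is \<^term>\<open>t\<close>.\<close>

definition Phi_inner :: "'a::metric_space measure \<Rightarrow> ennreal \<Rightarrow> ennreal" where
  "Phi_inner M t =
     min t (emeasure M (space M) / 2) / iso_profile M (min t (emeasure M (space M) / 2))"

text \<open>Extension to \<open>[0, \<mu>(\<Omega>)]\<close>; the right end point may be infinite. Larger arguments never occur
  as measures of level sets.\<close>

definition Phi :: "'a::metric_space measure \<Rightarrow> ennreal \<Rightarrow> ennreal" where
  "Phi M t =
     (if t = 0 then 0
      else if t < emeasure M (space M) then Phi_inner M t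
      else Lim (at_left (emeasure M (space M))) (Phi_inner M))"

definition marcinkiewicz_norm :: "(ennreal \<Rightarrow> ennreal) \<Rightarrow> 'a measure \<Rightarrow> ('a \<Rightarrow> real) \<Rightarrow> ennreal" where
  "marcinkiewicz_norm \<Phi> M h =
     (SUP t\<in>{0<..}. ennreal t * \<Phi> (emeasure M {x \<in> space M. t < \<bar>h x\<bar>}))"

definition marcinkiewicz_space :: "(ennreal \<Rightarrow> ennreal) \<Rightarrow> 'a measure \<Rightarrow> ('a \<Rightarrow> real) set" where
  "marcinkiewicz_space \<Phi> M = {h \<in> borel_measurable M. marcinkiewicz_norm \<Phi> M h < \<infinity>}"

definition L1_norm :: "'a measure \<Rightarrow> ('a \<Rightarrow> real) \<Rightarrow> ennreal" where
  "L1_norm M f = (\<integral>\<^sup>+x. ennreal \<bar>f x\<bar> \<partial>M)"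

definition ennreal_sqrt :: "ennreal \<Rightarrow> ennreal" where
  "ennreal_sqrt x = (if x = \<infinity> then \<infinity> else ennreal (sqrt (enn2real x)))"

end

theory Submission
  imports Defs
begin

text \<open>Write \<open>G\<close> for the integral of the gradient and \<open>L\<close> for the total mass. The core is the local
  bound \<open>\<integral>\<^sub>E \<bar>f\<bar> \<le> C \<Phi>\<^sub>2(\<mu>(E)) G\<close>. For \<open>f \<ge> 0\<close> with \<open>\<mu>{f > 0} \<le> L/2\<close> the left side is the integral over
  \<open>r > 0\<close> of \<open>\<mu>(E \<inter> {f > r}) \<le> min (\<mu>(E)) (\<mu>{f > r})\<close>. As \<open>t / I\<^sub>2(t)\<close> increases and \<open>I\<^sub>2\<close> increases up
  to \<open>L/2\<close>, this minimum is at most \<open>\<Phi>\<^sub>2(\<mu>(E)) I\<^sub>2(\<mu>{f > r})\<close>, and the coarea inequality bounds the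
  integral of \<open>I\<^sub>2(\<mu>{f > r}) \<le> \<mu>\<^sup>+{f > r}\<close> by \<open>G\<close>. Splitting the integral of \<open>\<bar>f\<bar>\<close> at the level set
  \<open>{1/w > s}\<close> and optimizing \<open>s\<close> gives the theorem.\<close>

section \<open>Isoperimetric profiles\<close>

context isoperimetric_space
begin

lemma iso_profile_real:
  assumes "t < emeasure M (space M)"
  shows "iso_profile M t = ennreal (enn2real (iso_profile M t))"
  using profile_finite[OF assms] by (simp add: less_top)

lemma concave_profile:
  assumes "0 \<le> a" "0 \<le> b" "ennreal a < emeasure M (space M)" "ennreal b < emeasure M (space M)"
    and "0 \<le> c" "c \<le> 1"
  shows "(1 - c) * enn2real (iso_profile M (ennreal a)) + c * enn2real (iso_profile M (ennreal b))
    \<le> enn2real (iso_profile M (ennreal ((1 - c) * a + c * b)))"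
  using concave_onD[OF profile_concave, of c a b] assms by simp

text \<open>Concavity on the chord from \<open>0\<close> to \<open>t\<close>, together with the
  value \<open>0\<close> at \<open>0\<close>, gives
  \<open>(s / t) * I(t) \<le> I(s)\<close>.\<close>

lemma ratio_mono:
  assumes "0 < s" "s \<le> t" "t < emeasure M (space M)"
  shows "s / iso_profile M s \<le> t / iso_profile M t"
proof -
  have "t < \<infinity>" "s < \<infinity>"
    using assms by (auto simp: less_top[symmetric] top_unique)
  then obtain a b where ab: "s = ennreal a" "t = ennreal b" "0 \<le> a" "0 \<le> b"
    by (metis ennreal_cases infinity_ennreal_def less_irrefl)
  define i where "i = (\<lambda>t. enn2real (iso_profile M (ennreal t)))"
  have "0 < a" "a \<le> b" using assms ab by auto
  have sL: "s < emeasure M (space M)" using assms by auto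
  have "0 < iso_profile M s" "0 < iso_profile M t"
    using assms profile_pos sL by auto
  then have pos: "0 < i a" "0 < i b"
    using profile_finite[OF sL] profile_finite[OF assms(3)]
    by (auto simp: i_def ab enn2real_positive_iff)
  have "(1 - a / b) * i 0 + (a / b) * i b \<le> i ((1 - a / b) * 0 + (a / b) * b)"
    unfolding i_def using assms ab \<open>0 < a\<close> \<open>a \<le> b\<close>
    by (intro concave_profile) (auto simp: field_simps intro: le_less_trans)
  then have "(a / b) * i b \<le> i a"
    using \<open>0 < a\<close> \<open>a \<le> b\<close> profile_zero by (simp add: i_def)
  then have "a / i a \<le> b / i b"
    using pos \<open>0 < a\<close> \<open>a \<le> b\<close> by (simp add: field_simps)
  moreover have "iso_profile M s = ennreal (i a)" "iso_profile M t = ennreal (i b)"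
    using iso_profile_real[OF sL] iso_profile_real[OF assms(3)] by (simp_all add: i_def ab)
  ultimately show ?thesis
    using pos ab by (simp add: divide_ennreal)
qed

text \<open>For finite mass \<open>l\<close>, symmetry gives the profile equal values at
  \<open>a\<close> and \<open>l - a\<close>; as \<open>b \<le> l / 2\<close> lies between these
  points, concavity makes the value at \<open>b\<close> at least as large. For infinite mass,
  monotonicity is an axiom of the locale.\<close>

lemma profile_mono_half:
  assumes "s \<le> t" "t < emeasure M (space M)" "t \<le> emeasure M (space M) / 2"
  shows "iso_profile M s \<le> iso_profile M t"
proof (cases "emeasure M (space M) = \<infinity>")
  case True
  then show ?thesis
    using profile_increasing assms by (auto simp: mono_on_def intro: le_less_trans)
next
  case False
  then obtain l where l: "emeasure M (space M) = ennreal l" "0 \<le> l"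
    by (metis ennreal_cases infinity_ennreal_def)
  show ?thesis
  proof (cases "s = 0 \<or> s = t")
    case True
    then show ?thesis using profile_zero by auto
  next
    case ne: False
    have "t < \<infinity>" "s < \<infinity>"
      using assms by (auto simp: less_top[symmetric] top_unique)
    then obtain a b where ab: "s = ennreal a" "t = ennreal b" "0 \<le> a" "0 \<le> b"
      by (metis ennreal_cases infinity_ennreal_def less_irrefl)
    have "ennreal b \<le> ennreal (l / 2)"
      using assms l ab by (metis divide_ennreal ennreal_numeral zero_less_numeral zero_le_numeral)
    then have b: "b \<le> l / 2" using l by (simp add: ennreal_le_iff)
    have a: "0 < a" "a < b" using ne assms ab
      by (auto simp: less_le)
    define i where "i = (\<lambda>t. enn2real (iso_profile M (ennreal t)))"
    have sL: "s < emeasure M (space M)" using assms by auto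
    have "iso_profile M (emeasure M (space M) - s) = iso_profile M s"
      using profile_symmetric[of s] sL ne False by (auto simp: less_top zero_less_iff_neq_zero)
    then have sym: "i (l - a) = i a"
      using a by (simp add: i_def l ab ennreal_minus)
    \<comment> \<open>The weight with \<open>b = (1 - c) * a + c * (l - a)\<close>; its denominator
      is positive because \<open>a < b\<close> and \<open>b \<le> l / 2\<close>.\<close>
    define c where "c = (b - a) / (l - 2 * a)"
    have "(1 - c) * i a + c * i (l - a) \<le> i ((1 - c) * a + c * (l - a))"
      unfolding i_def c_def using a b l
      by (intro concave_profile) (auto simp: field_simps ennreal_less_iff)
    also have "(1 - c) * a + c * (l - a) = b"
    proof -
      have "(1 - c) * a + c * (l - a) = a + c * (l - 2 * a)" by (simp add: algebra_simps)
      also have "\<dots> = b" unfolding c_def using a b by simp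
      finally show ?thesis .
    qed
    finally have "i a \<le> i b" using sym by (simp add: algebra_simps)
    then show ?thesis
      using iso_profile_real[OF sL] iso_profile_real[OF assms(2)] unfolding i_def ab
      by (metis ennreal_leI)
  qed
qed

section \<open>The function \<open>Phi\<close> and its products with the profile\<close>

lemma half_less:
  assumes "0 < emeasure M (space M)" "emeasure M (space M) < \<infinity>"
  shows "0 < emeasure M (space M) / 2" "emeasure M (space M) / 2 < emeasure M (space M)"
proof -
  obtain l where l: "emeasure M (space M) = ennreal l" "0 \<le> l"
    using assms by (metis ennreal_cases infinity_ennreal_def less_irrefl)
  have "ennreal l / 2 = ennreal (l / 2)"
    using l by (metis divide_ennreal ennreal_numeral zero_less_numeral zero_le_numeral)
  then show "0 < emeasure M (space M) / 2" "emeasure M (space M) / 2 < emeasure M (space M)"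
    using l assms by (auto simp: ennreal_less_iff)
qed

lemma min_half_less:
  assumes "t < emeasure M (space M)"
  shows "min t (emeasure M (space M) / 2) < emeasure M (space M)"
  using assms by (auto simp: min_def)

lemma Phi_inner_mono:
  assumes "0 < s" "s \<le> t" "t < emeasure M (space M)"
  shows "Phi_inner M s \<le> Phi_inner M t"
proof -
  have "0 < emeasure M (space M) / 2"
    using assms by (auto simp: ennreal_zero_less_divide)
  then show ?thesis
    unfolding Phi_inner_def using assms
    by (intro ratio_mono min_half_less) (auto simp: min_def)
qed

text \<open>\<open>Phi_inner M\<close> is increasing below the total mass, so its left limit exists
  and is the supremum. This treats finite and infinite mass together.\<close>

lemma Phi_end:
  assumes "0 < emeasure M (space M)"
  shows "Phi M (emeasure M (space M)) = (SUP t\<in>{0<..<emeasure M (space M)}. Phi_inner M t)"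
proof -
  let ?L = "emeasure M (space M)"
  have nb: "at_left ?L \<noteq> bot"
    using assms dense by (auto simp: trivial_limit_def eventually_at_left[OF assms])
  have "(Phi_inner M \<longlongrightarrow> (SUP t\<in>{0<..<?L}. Phi_inner M t)) (at_left ?L)"
  proof (rule order_tendstoI)
    fix y assume "y < (SUP t\<in>{0<..<?L}. Phi_inner M t)"
    then obtain t where t: "0 < t" "t < ?L" "y < Phi_inner M t" by (auto simp: less_SUP_iff)
    then have "eventually (\<lambda>s. s \<in> {t<..<?L}) (at_left ?L)"
      by (auto simp: eventually_at_left[OF assms])
    then show "eventually (\<lambda>s. y < Phi_inner M s) (at_left ?L)"
      by eventually_elim (use t Phi_inner_mono[OF t(1)] in \<open>force intro: less_le_trans\<close>)
  next
    fix y assume y: "y > (SUP t\<in>{0<..<?L}. Phi_inner M t)"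
    have "eventually (\<lambda>s. s \<in> {0<..<?L}) (at_left ?L)"
      using assms by (auto simp: eventually_at_left[OF assms])
    then show "eventually (\<lambda>s. y > Phi_inner M s) (at_left ?L)"
      by eventually_elim (rule le_less_trans[OF SUP_upper y])
  qed
  then have "Lim (at_left ?L) (Phi_inner M) = (SUP t\<in>{0<..<?L}. Phi_inner M t)"
    by (rule tendsto_Lim[OF nb])
  then show ?thesis using assms by (simp add: Phi_def)
qed

text \<open>For \<open>v = min t u\<close>, write \<open>v = (v / I(v)) * I(v)\<close>. The quotient
  is at most \<open>Phi_inner M t\<close> because \<open>v\<close> is at most both \<open>t\<close>
  and \<open>L / 2\<close>, and \<open>I(v) \<le> I(u)\<close> because \<open>u\<close> is in the
  lower half.\<close>

lemma min_le_Phi_mult_profile: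
  assumes "t \<le> emeasure M (space M)" "u < emeasure M (space M)" "u \<le> emeasure M (space M) / 2"
  shows "min t u \<le> Phi M t * iso_profile M u"
proof -
  let ?L = "emeasure M (space M)"
  have inner: "min t u \<le> Phi_inner M t * iso_profile M u" if t: "t < ?L" "0 < min t u" for t
  proof -
    let ?v = "min t u"
    have vL: "?v < ?L" using t(1) by (auto simp: min_def)
    have "?v / iso_profile M ?v \<le> Phi_inner M t"
      unfolding Phi_inner_def using t assms
      by (intro ratio_mono min_half_less) (auto simp: min_def)
    moreover have "iso_profile M ?v \<le> iso_profile M u"
      using assms by (intro profile_mono_half) auto
    ultimately have "(?v / iso_profile M ?v) * iso_profile M ?v \<le> Phi_inner M t * iso_profile M u"
      by (rule mult_mono) auto
    also have "(?v / iso_profile M ?v) * iso_profile M ?v = ?v"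
      using profile_pos[OF t(2) vL] profile_finite[OF vL]
      by (simp add: ennreal_divide_times mult_divide_eq_ennreal less_top)
    finally show ?thesis .
  qed
  show ?thesis
  proof (cases "0 < min t u")
    case True
    show ?thesis
    proof (cases "t < ?L")
      case t: True
      then show ?thesis using inner[OF t True] True by (auto simp: Phi_def)
    next
      case False
      then have t: "t = ?L" using assms by auto
      \<comment> \<open>At \<open>t = L\<close> the value of \<open>Phi\<close> is a limit, so the
        inner bound is applied at \<open>u\<close> and then absorbed by the supremum.\<close>
      have "min t u = min u u" using assms t by auto
      also have "\<dots> \<le> Phi_inner M u * iso_profile M u"
        using assms True by (intro inner) auto
      also have "\<dots> \<le> Phi M t * iso_profile M u"
        unfolding t using assms True t by (subst Phi_end) (auto intro!: mult_right_mono SUP_upper)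
      finally show ?thesis .
    qed
  qed (auto simp: not_less)
qed

text \<open>Since \<open>min t (L / 2)\<close> never exceeds \<open>L / 2\<close>, every
  \<open>Phi_inner M t\<close> is at most the quotient at \<open>L / 2\<close>. This is used to
  control the median of a function of mean zero.\<close>

lemma Phi_space_mult_profile:
  assumes "0 < emeasure M (space M)" "emeasure M (space M) < \<infinity>"
  shows "Phi M (emeasure M (space M)) * iso_profile M (emeasure M (space M) / 2)
    \<le> emeasure M (space M) / 2"
proof -
  let ?L = "emeasure M (space M)"
  note h = half_less[OF assms]
  have "Phi M ?L \<le> (?L / 2) / iso_profile M (?L / 2)"
    unfolding Phi_end[OF assms(1)] Phi_inner_def using h
    by (intro SUP_least ratio_mono) auto
  then have "Phi M ?L * iso_profile M (?L / 2)
      \<le> (?L / 2) / iso_profile M (?L / 2) * iso_profile M (?L / 2)"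
    by (rule mult_right_mono) simp
  also have "\<dots> = ?L / 2"
    using profile_pos[OF h] profile_finite[OF h(2)]
    by (simp add: ennreal_divide_times mult_divide_eq_ennreal less_top)
  finally show ?thesis .
qed

end

section \<open>The coarea inequality\<close>

text \<open>Fubini for the region \<open>a x \<le> r < b x\<close>. Where \<open>b x < a x\<close>
  the section is empty and \<open>ennreal\<close> truncates the difference to \<open>0\<close>, so
  both sides agree. It serves the coarea inequality with \<open>a = g\<close> and the local bound
  with \<open>a = 0\<close>.\<close>

lemma layer_cake_between:
  fixes a b :: "'a \<Rightarrow> real"
  assumes "sigma_finite_measure N"
    and [measurable]: "a \<in> borel_measurable N" "b \<in> borel_measurable N"
  shows "(\<lambda>r. emeasure N {x \<in> space N. a x \<le> r \<and> r < b x}) \<in> borel_measurable lborel"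
    and "(\<integral>\<^sup>+x. ennreal (b x - a x) \<partial>N)
      = (\<integral>\<^sup>+r. emeasure N {x \<in> space N. a x \<le> r \<and> r < b x} \<partial>lborel)"
proof -
  interpret N: sigma_finite_measure N by fact
  interpret P: pair_sigma_finite N lborel ..
  define F where "F = (\<lambda>(x, r). indicator {p. a (fst p) \<le> snd p \<and> snd p < b (fst p)} (x, r) :: ennreal)"
  have F [measurable]: "F \<in> borel_measurable (N \<Otimes>\<^sub>M lborel)"
    unfolding F_def by measurable
  have 1: "(\<integral>\<^sup>+r. F (x, r) \<partial>lborel) = ennreal (b x - a x)" for x
  proof -
    have "(\<integral>\<^sup>+r. F (x, r) \<partial>lborel) = (\<integral>\<^sup>+r. indicator {a x ..< b x} r \<partial>lborel)"
      by (intro nn_integral_cong) (auto simp: F_def indicator_def)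
    also have "\<dots> = ennreal (b x - a x)"
      by (cases "a x \<le> b x") (auto simp: ennreal_neg)
    finally show ?thesis .
  qed
  have 2: "(\<integral>\<^sup>+x. F (x, r) \<partial>N) = emeasure N {x \<in> space N. a x \<le> r \<and> r < b x}" for r
  proof -
    have "(\<integral>\<^sup>+x. F (x, r) \<partial>N) = (\<integral>\<^sup>+x. indicator {x \<in> space N. a x \<le> r \<and> r < b x} x \<partial>N)"
      by (intro nn_integral_cong) (auto simp: F_def indicator_def)
    also have "\<dots> = emeasure N {x \<in> space N. a x \<le> r \<and> r < b x}"
      by (rule nn_integral_indicator) measurable
    finally show ?thesis .
  qed
  show "(\<lambda>r. emeasure N {x \<in> space N. a x \<le> r \<and> r < b x}) \<in> borel_measurable lborel"
    unfolding 2[symmetric] by measurable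
  show "(\<integral>\<^sup>+x. ennreal (b x - a x) \<partial>N)
      = (\<integral>\<^sup>+r. emeasure N {x \<in> space N. a x \<le> r \<and> r < b x} \<partial>lborel)"
    unfolding 1[symmetric] 2[symmetric] by (rule P.Fubini'[symmetric]) simp
qed

section \<open>Suprema over balls and their superlevel sets\<close>

definition ball_sup :: "('a::metric_space \<Rightarrow> real) \<Rightarrow> real \<Rightarrow> 'a \<Rightarrow> real" where
  "ball_sup g h x = (SUP y\<in>ball x h. g y)"

lemma enlargement_eq_UN: "enlargement A h = (\<Union>a\<in>A. ball a h)"
  by (auto simp: enlargement_def dist_commute)

lemma bdd_above_ball_lipschitz:
  fixes g :: "'a::metric_space \<Rightarrow> real"
  assumes "K-lipschitz_on UNIV g"
  shows "bdd_above (g ` ball x h)"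
proof (rule bdd_aboveI2)
  fix y assume "y \<in> ball x h"
  then have "\<bar>g y - g x\<bar> \<le> K * h"
    using lipschitz_onD[OF assms, of y x] mult_left_mono[OF _ lipschitz_on_nonneg[OF assms], of "dist x y" h]
    by (auto simp: dist_real_def dist_commute)
  then show "g y \<le> g x + K * h" by linarith
qed

text \<open>A number strictly below a supremum is exceeded at some point of the open ball. This
  links Minkowski contents of superlevel sets to difference quotients of
  \<open>ball_sup\<close>.\<close>

lemma less_ball_sup_iff:
  fixes g :: "'a::metric_space \<Rightarrow> real"
  assumes "K-lipschitz_on UNIV g" "0 < h"
  shows "r < ball_sup g h x \<longleftrightarrow> x \<in> enlargement {x. r < g x} h"
  unfolding ball_sup_def using assms
  by (subst less_cSUP_iff) (auto simp: bdd_above_ball_lipschitz enlargement_def)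

lemma ball_sup_ge:
  fixes g :: "'a::metric_space \<Rightarrow> real"
  assumes "K-lipschitz_on UNIV g" "0 < h"
  shows "g x \<le> ball_sup g h x"
  unfolding ball_sup_def using assms
  by (intro cSUP_upper) (auto simp: bdd_above_ball_lipschitz)

lemma ball_sup_le:
  assumes "0 < h" "\<And>y. dist x y < h \<Longrightarrow> g y \<le> c"
  shows "ball_sup g h x \<le> c"
  unfolding ball_sup_def using assms by (intro cSUP_least) auto

lemma ball_sup_le_lipschitz:
  fixes g :: "'a::metric_space \<Rightarrow> real"
  assumes "K-lipschitz_on UNIV g" "0 < h"
  shows "ball_sup g h x \<le> g x + K * h"
proof (rule ball_sup_le[OF assms(2)])
  fix y assume "dist x y < h"
  then have "\<bar>g y - g x\<bar> \<le> K * h"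
    using lipschitz_onD[OF assms(1), of y x] mult_left_mono[OF _ lipschitz_on_nonneg[OF assms(1)], of "dist x y" h]
    by (auto simp: dist_real_def dist_commute)
  then show "g y \<le> g x + K * h" by linarith
qed

lemma borel_measurable_ball_sup:
  fixes g :: "'a::metric_space \<Rightarrow> real"
  assumes "K-lipschitz_on UNIV g" "0 < h"
  shows "ball_sup g h \<in> borel_measurable borel"
proof (rule borel_measurableI_greater)
  fix r
  have "{x \<in> space borel. r < ball_sup g h x} = enlargement {x. r < g x} h"
    using less_ball_sup_iff[OF assms] by auto
  moreover have "open \<dots>" unfolding enlargement_eq_UN by auto
  ultimately show "{x \<in> space borel. r < ball_sup g h x} \<in> sets borel" by simp
qed

text \<open>If \<open>r\<close> exceeds the gradient modulus, then
  \<open>g y \<le> g x + r * dist x y\<close> near \<open>x\<close>, so on a small ball of radius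
  \<open>h\<close> the supremum exceeds \<open>g x\<close> by at most \<open>r * h\<close>.\<close>

lemma limsup_ball_sup_le_grad_modulus:
  fixes g :: "'a::metric_space \<Rightarrow> real"
  shows "limsup (\<lambda>n. ennreal (real (Suc n) * (ball_sup g (1 / real (Suc n)) x - g x)))
    \<le> grad_modulus g x"
proof (rule ccontr)
  assume "\<not> ?thesis"
  then obtain c where c: "grad_modulus g x < c"
    "c < limsup (\<lambda>n. ennreal (real (Suc n) * (ball_sup g (1 / real (Suc n)) x - g x)))"
    using dense by (auto simp: not_le)
  then have "c < \<infinity>" by (auto intro: less_le_trans)
  then obtain r where r: "c = ennreal r" "0 \<le> r"
    by (metis ennreal_cases infinity_ennreal_def less_irrefl)
  have "eventually (\<lambda>y. ennreal (\<bar>g x - g y\<bar> / dist x y) < c) (at x)"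
    using c(1) unfolding grad_modulus_def by (rule Limsup_lessD)
  then obtain d where d: "d > 0"
    "\<And>y. y \<noteq> x \<Longrightarrow> dist y x < d \<Longrightarrow> ennreal (\<bar>g x - g y\<bar> / dist x y) < c"
    by (auto simp: eventually_at)
  have le: "g y \<le> g x + r * dist x y" if "dist x y < d" for y
  proof (cases "y = x")
    case False
    then have "\<bar>g x - g y\<bar> / dist x y < r"
      using d(2)[of y] that r by (auto simp: dist_commute ennreal_less_iff)
    then show ?thesis using False by (auto simp: field_simps)
  qed auto
  have "eventually (\<lambda>n. 1 / real (Suc n) < d) sequentially"
    using LIMSEQ_inverse_real_of_nat d(1) by (auto dest!: order_tendstoD(2) simp: inverse_eq_divide)
  then have "eventually (\<lambda>n. ennreal (real (Suc n) * (ball_sup g (1 / real (Suc n)) x - g x)) \<le> c) sequentially"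
  proof eventually_elim
    case (elim n)
    have "ball_sup g (1 / real (Suc n)) x \<le> g x + r * (1 / real (Suc n))"
    proof (rule ball_sup_le)
      fix y assume y: "dist x y < 1 / real (Suc n)"
      then have "g y \<le> g x + r * dist x y" using elim by (intro le) auto
      also have "\<dots> \<le> g x + r * (1 / real (Suc n))"
        using y r by (intro add_left_mono mult_left_mono) auto
      finally show "g y \<le> g x + r * (1 / real (Suc n))" .
    qed auto
    then have "real (Suc n) * (ball_sup g (1 / real (Suc n)) x - g x) \<le> r"
      by (simp add: field_simps)
    then show ?case using r by (simp add: ennreal_leI)
  qed
  then have "limsup (\<lambda>n. ennreal (real (Suc n) * (ball_sup g (1 / real (Suc n)) x - g x))) \<le> c"
    by (rule Limsup_bounded)
  then show False using c by auto
qed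

text \<open>Restricting a lower limit to the radii \<open>1 / (n + 1)\<close> can only raise it; the
  Fatou lemmas take such a sequence.\<close>

lemma outer_minkowski_le_liminf:
  "outer_minkowski M A \<le> liminf (\<lambda>n. ennreal (real (Suc n)) *
     (emeasure M (enlargement A (1 / real (Suc n))) - emeasure M A))"
proof -
  let ?h = "\<lambda>n. 1 / real (Suc n)"
  let ?q = "\<lambda>h. (emeasure M (enlargement A h) - emeasure M A) / ennreal h"
  have "filterlim ?h (at_right 0) sequentially"
    using LIMSEQ_inverse_real_of_nat
    by (auto simp: filterlim_at eventually_at_filter inverse_eq_divide)
  then have "Liminf (at_right 0) ?q \<le> Liminf (filtermap ?h sequentially) ?q"
    unfolding Liminf_def filterlim_def by (auto intro!: SUP_subset_mono simp: le_filter_def)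
  also have "\<dots> \<le> liminf (\<lambda>n. ?q (?h n))" by (rule Liminf_filtermap_le)
  also have "(\<lambda>n. ?q (?h n)) = (\<lambda>n. ennreal (real (Suc n)) * (emeasure M (enlargement A (?h n)) - emeasure M A))"
  proof
    fix n
    have "inverse (ennreal (1 / real (Suc n))) = ennreal (real (Suc n))"
      by (subst inverse_ennreal) auto
    then show "?q (?h n) = ennreal (real (Suc n)) * (emeasure M (enlargement A (?h n)) - emeasure M A)"
      by (simp add: divide_ennreal_def mult.commute del: of_nat_Suc)
  qed
  finally show ?thesis unfolding outer_minkowski_def .
qed

text \<open>Superlevel sets of \<open>g\<close> at a positive level have enlargements contained in
  \<open>{x. 0 < g x}\<close>, a set of finite measure; this is what permits both Fubini and the reverse
  Fatou lemma although \<open>M\<close> need not be sigma-finite.\<close>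

lemma coarea_inequality:
  fixes M :: "'a::metric_space measure"
  assumes M: "sets M = sets borel" and lip: "K-lipschitz_on UNIV g"
    and fin: "emeasure M {x. 0 < g x} < \<infinity>"
  obtains J where "J \<in> borel_measurable lborel"
    "\<And>r. 0 < r \<Longrightarrow> outer_minkowski M {x. r < g x} \<le> J r"
    "(\<integral>\<^sup>+r. J r \<partial>lborel) \<le> (\<integral>\<^sup>+x. grad_modulus g x \<partial>M)"
proof -
  note [measurable_cong] = M
  have space: "space M = UNIV" using sets_eq_imp_space_eq[OF M] by simp
  define N where "N = density M (indicator {x. 0 < g x})"
  define s where "s = (\<lambda>n. ball_sup g (1 / real (Suc n)))"
  have "continuous_on UNIV g" using lip by (rule lipschitz_on_continuous_on)
  then have gM [measurable]: "g \<in> borel_measurable borel" by (rule borel_measurable_continuous_onI)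
  have sM [measurable]: "s n \<in> borel_measurable borel" for n
    unfolding s_def using lip by (intro borel_measurable_ball_sup) auto
  have U [measurable]: "{x. 0 < g x} \<in> sets M" by measurable
  have setsN [measurable_cong]: "sets N = sets borel" by (simp add: N_def M)
  have spaceN: "space N = UNIV" by (simp add: N_def space)
  have emN: "emeasure N A = emeasure M ({x. 0 < g x} \<inter> A)" if "A \<in> sets M" for A
    unfolding N_def using that by (rule emeasure_restricted[OF U])
  have finN: "emeasure N UNIV < \<infinity>"
    using fin emN[of UNIV] space sets.top[of M] by simp
  interpret N: finite_measure N
    by standard (use finN spaceN in auto)
  define G where "G = (\<lambda>n r. ennreal (real (Suc n)) * emeasure N {x \<in> space N. g x \<le> r \<and> r < s n x})"
  have GM [measurable]: "G n \<in> borel_measurable lborel" for n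
    unfolding G_def by (intro borel_measurable_times_ennreal layer_cake_between)
      (auto intro: N.sigma_finite_measure_axioms)
  \<comment> \<open>A measurable majorant, in the level \<open>r\<close>, that stands in for the
    Minkowski content under the integral.\<close>
  define J where "J = (\<lambda>r. liminf (\<lambda>n. G n r))"
  have "J \<in> borel_measurable lborel" unfolding J_def by measurable
  moreover have "outer_minkowski M {x. r < g x} \<le> J r" if "0 < r" for r
  proof -
    let ?A = "{x. r < g x}"
    have A [measurable]: "?A \<in> sets M" by measurable
    \<comment> \<open>Moving by less than \<open>1 / (n + 1)\<close> changes \<open>g\<close> by at
      most \<open>K / (n + 1)\<close>. Once this is below \<open>r\<close>, the enlargement stays
      inside \<open>{x. 0 < g x}\<close>, where \<open>N\<close> and \<open>M\<close> agree.\<close>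
    have "eventually (\<lambda>n. K / real (Suc n) < r) sequentially"
    proof -
      have "(\<lambda>n. K * inverse (real (Suc n))) \<longlonglongrightarrow> K * 0"
        by (intro tendsto_intros LIMSEQ_inverse_real_of_nat)
      then show ?thesis using that by (auto dest!: order_tendstoD(2) simp: divide_inverse)
    qed
    then have "eventually (\<lambda>n. ennreal (real (Suc n)) *
        (emeasure M (enlargement ?A (1 / real (Suc n))) - emeasure M ?A) = G n r) sequentially"
    proof eventually_elim
      case (elim n)
      have en: "enlargement ?A (1 / real (Suc n)) = {x. r < s n x}"
        using less_ball_sup_iff[OF lip, of "1 / real (Suc n)"] by (auto simp: s_def)
      have mono: "?A \<subseteq> {x. r < s n x}"
        using ball_sup_ge[OF lip, of "1 / real (Suc n)"] by (auto simp: s_def intro: less_le_trans)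
      have diff: "{x. r < s n x} - ?A = {x. g x \<le> r \<and> r < s n x}" by auto
      have sub: "{x. g x \<le> r \<and> r < s n x} \<subseteq> {x. 0 < g x}"
      proof safe
        fix x assume "r < s n x"
        also have "s n x \<le> g x + K * (1 / real (Suc n))"
          unfolding s_def using lip by (rule ball_sup_le_lipschitz) auto
        finally show "0 < g x" using elim by simp
      qed
      have "emeasure M ?A \<le> emeasure M {x. 0 < g x}"
        using that U by (intro emeasure_mono) auto
      then have "emeasure M ?A \<noteq> \<infinity>" using fin by auto
      then have "emeasure M {x. r < s n x} - emeasure M ?A = emeasure M {x. g x \<le> r \<and> r < s n x}"
        unfolding diff[symmetric] using mono by (intro emeasure_Diff[symmetric]) measurable
      also have "\<dots> = emeasure N {x. g x \<le> r \<and> r < s n x}"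
        using sub by (subst emN) (auto simp: Int_absorb1 intro: arg_cong[where f = "emeasure M"])
      finally show ?case by (simp add: en G_def spaceN del: of_nat_Suc)
    qed
    then have "liminf (\<lambda>n. ennreal (real (Suc n)) *
        (emeasure M (enlargement ?A (1 / real (Suc n))) - emeasure M ?A)) = J r"
      unfolding J_def by (rule Liminf_eq)
    then show ?thesis using outer_minkowski_le_liminf[of M ?A] by simp
  qed
  moreover have "(\<integral>\<^sup>+r. J r \<partial>lborel) \<le> (\<integral>\<^sup>+x. grad_modulus g x \<partial>M)"
  proof -
    \<comment> \<open>Fatou in \<open>r\<close>, Fubini for each \<open>n\<close>, then reverse
      Fatou in \<open>x\<close>: the quotients are dominated by the constant \<open>K\<close>, which
      is integrable for the finite measure \<open>N\<close>.\<close>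
    let ?q = "\<lambda>n x. ennreal (real (Suc n) * (s n x - g x))"
    have "(\<integral>\<^sup>+r. J r \<partial>lborel) \<le> liminf (\<lambda>n. \<integral>\<^sup>+r. G n r \<partial>lborel)"
      unfolding J_def by (rule nn_integral_liminf) simp
    also have "(\<lambda>n. \<integral>\<^sup>+r. G n r \<partial>lborel) = (\<lambda>n. \<integral>\<^sup>+x. ?q n x \<partial>N)"
    proof
      fix n
      have "(\<integral>\<^sup>+r. G n r \<partial>lborel) = ennreal (real (Suc n)) * (\<integral>\<^sup>+x. ennreal (s n x - g x) \<partial>N)"
        unfolding G_def
        by (subst layer_cake_between(2)) (auto intro!: nn_integral_cmult layer_cake_between(1) N.sigma_finite_measure_axioms)
      also have "\<dots> = (\<integral>\<^sup>+x. ?q n x \<partial>N)"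
        by (subst nn_integral_cmult[symmetric]) (auto simp: ennreal_mult' simp del: of_nat_Suc)
      finally show "(\<integral>\<^sup>+r. G n r \<partial>lborel) = (\<integral>\<^sup>+x. ?q n x \<partial>N)" .
    qed
    also have "liminf (\<lambda>n. \<integral>\<^sup>+x. ?q n x \<partial>N) \<le> limsup (\<lambda>n. \<integral>\<^sup>+x. ?q n x \<partial>N)"
      by (rule Liminf_le_Limsup) simp
    also have "\<dots> \<le> (\<integral>\<^sup>+x. limsup (\<lambda>n. ?q n x) \<partial>N)"
    proof (rule nn_integral_limsup[where w = "\<lambda>_. ennreal K"])
      show "AE x in N. ?q n x \<le> ennreal K" for n
      proof (rule AE_I2)
        fix x
        have "s n x \<le> g x + K * (1 / real (Suc n))"
          unfolding s_def using lip by (rule ball_sup_le_lipschitz) auto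
        then show "?q n x \<le> ennreal K" by (intro ennreal_leI) (simp add: field_simps)
      qed
      show "(\<integral>\<^sup>+x. ennreal K \<partial>N) < \<infinity>"
        using finN by (simp add: spaceN ennreal_mult_less_top)
    qed auto
    also have "\<dots> = (\<integral>\<^sup>+x. indicator {x. 0 < g x} x * limsup (\<lambda>n. ?q n x) \<partial>M)"
      unfolding N_def by (rule nn_integral_density) measurable
    also have "\<dots> \<le> (\<integral>\<^sup>+x. grad_modulus g x \<partial>M)"
      using limsup_ball_sup_le_grad_modulus[of g]
      by (intro nn_integral_mono) (auto simp: s_def indicator_def simp del: of_nat_Suc)
    finally show ?thesis .
  qed
  ultimately show thesis by (rule that)
qed

section \<open>The local bound\<close>

lemma grad_modulus_mono:
  assumes "\<And>x y. \<bar>g x - g y\<bar> \<le> \<bar>f x - f y\<bar>"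
  shows "grad_modulus g x \<le> grad_modulus f x"
  unfolding grad_modulus_def
  by (intro Limsup_mono always_eventually) (auto intro!: ennreal_leI divide_right_mono assms)

text \<open>The layer-cake formula over \<open>E\<close> reduces the claim to one level at a time.
  For infinite mass, \<open>less\<close> supplies the finite measure of \<open>{x. 0 < g x}\<close>
  on which Fubini and the coarea inequality rely.\<close>

lemma set_nn_integral_le_Phi_grad:
  fixes M1 :: "'a::metric_space measure" and M2 :: "'b::metric_space measure"
  assumes "isoperimetric_space M1" "isoperimetric_space M2"
    and eq: "emeasure M1 (space M1) = emeasure M2 (space M2)"
    and le: "\<And>t. t < emeasure M1 (space M1) \<Longrightarrow> iso_profile M2 t \<le> iso_profile M1 t"
    and lip: "K-lipschitz_on UNIV g" and g0: "\<And>x. 0 \<le> g x"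
    and half: "emeasure M1 {x. 0 < g x} \<le> emeasure M1 (space M1) / 2"
    and less: "emeasure M1 {x. 0 < g x} < emeasure M1 (space M1)"
    and E: "E \<in> sets M1"
  shows "(\<integral>\<^sup>+x\<in>E. ennreal (g x) \<partial>M1) \<le> Phi M2 (emeasure M1 E) * (\<integral>\<^sup>+x. grad_modulus g x \<partial>M1)"
proof -
  interpret M1: isoperimetric_space M1 by fact
  interpret M2: isoperimetric_space M2 by fact
  note M = M1.borel_measure
  note [measurable_cong] = M
  note [measurable] = E
  have space: "space M1 = UNIV" using sets_eq_imp_space_eq[OF M] by simp
  have fin: "emeasure M1 {x. 0 < g x} < \<infinity>" using less by (auto intro: less_le_trans)
  obtain J where J [measurable]: "J \<in> borel_measurable lborel"
    and minkowski: "\<And>r. 0 < r \<Longrightarrow> outer_minkowski M1 {x. r < g x} \<le> J r"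
    and Jint: "(\<integral>\<^sup>+r. J r \<partial>lborel) \<le> (\<integral>\<^sup>+x. grad_modulus g x \<partial>M1)"
    using coarea_inequality[OF M lip fin] by blast
  \<comment> \<open>\<open>g\<close> vanishes off \<open>{x. 0 < g x}\<close>, so its integral over
    \<open>E\<close> is unchanged by this restriction to a finite measure.\<close>
  define N where "N = density M1 (indicator {x. 0 < g x})"
  have "continuous_on UNIV g" using lip by (rule lipschitz_on_continuous_on)
  then have gM [measurable]: "g \<in> borel_measurable borel" by (rule borel_measurable_continuous_onI)
  have U [measurable]: "{x. 0 < g x} \<in> sets M1" by measurable
  have setsN [measurable_cong]: "sets N = sets M1" by (simp add: N_def)
  have spaceN: "space N = UNIV" by (simp add: N_def space)
  have emN: "emeasure N A = emeasure M1 ({x. 0 < g x} \<inter> A)" if "A \<in> sets M1" for A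
    unfolding N_def using U that by (rule emeasure_restricted)
  interpret N: finite_measure N
    by standard (use fin spaceN space emN[of UNIV] sets.top[of M1] in auto)
  define b where "b = (\<lambda>x. g x * indicator E x)"
  have b [measurable]: "b \<in> borel_measurable N" unfolding b_def by measurable
  have "(\<integral>\<^sup>+x\<in>E. ennreal (g x) \<partial>M1) = (\<integral>\<^sup>+x. indicator {x. 0 < g x} x * ennreal (b x - 0) \<partial>M1)"
    using g0 by (intro nn_integral_cong) (auto simp: b_def indicator_def not_less intro: antisym)
  also have "\<dots> = (\<integral>\<^sup>+x. ennreal (b x - 0) \<partial>N)"
    unfolding N_def by (rule nn_integral_density[symmetric]) (simp_all add: b_def)
  also have "\<dots> = (\<integral>\<^sup>+r. emeasure N {x \<in> space N. 0 \<le> r \<and> r < b x} \<partial>lborel)"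
    by (rule layer_cake_between) (auto intro: N.sigma_finite_measure_axioms)
  also have "\<dots> \<le> (\<integral>\<^sup>+r. Phi M2 (emeasure M1 E) * J r \<partial>lborel)"
  proof (rule nn_integral_mono_AE)
    \<comment> \<open>Level \<open>0\<close> is discarded because the Minkowski bound is available
      only for \<open>r > 0\<close>; negative levels give the empty set.\<close>
    have "AE r in lborel. r \<noteq> (0::real)" by (rule AE_lborel_singleton)
    then show "AE r in lborel. emeasure N {x \<in> space N. 0 \<le> r \<and> r < b x} \<le> Phi M2 (emeasure M1 E) * J r"
    proof eventually_elim
      case (elim r)
      show ?case
      proof (cases "r < 0")
        case False
        then have r: "0 < r" using elim by simp
        let ?A = "{x. r < g x}"
        have A [measurable]: "?A \<in> sets M1" by measurable
        have "emeasure M1 ?A \<le> emeasure M1 {x. 0 < g x}"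
          using r by (intro emeasure_mono) auto
        then have Ah: "emeasure M1 ?A \<le> emeasure M1 (space M1) / 2"
          and AL: "emeasure M1 ?A < emeasure M1 (space M1)"
          using half less by auto
        have "{x \<in> space N. 0 \<le> r \<and> r < b x} = ?A \<inter> E"
          using r spaceN by (auto simp: b_def indicator_def)
        then have "emeasure N {x \<in> space N. 0 \<le> r \<and> r < b x} = emeasure N (?A \<inter> E)" by simp
        also have "\<dots> = emeasure M1 ({x. 0 < g x} \<inter> (?A \<inter> E))" by (rule emN) measurable
        also have "\<dots> \<le> min (emeasure M1 E) (emeasure M1 ?A)"
          by (intro min.boundedI emeasure_mono) auto
        \<comment> \<open>Equality of the masses lets the profile of \<open>M2\<close> be evaluated
          at measures of level sets in \<open>M1\<close>.\<close>
        also have "\<dots> \<le> Phi M2 (emeasure M1 E) * iso_profile M2 (emeasure M1 ?A)"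
          using Ah AL E by (intro M2.min_le_Phi_mult_profile) (auto simp: eq[symmetric] emeasure_space)
        also have "iso_profile M2 (emeasure M1 ?A) \<le> iso_profile M1 (emeasure M1 ?A)"
          using AL by (rule le)
        also have "iso_profile M1 (emeasure M1 ?A) \<le> outer_minkowski M1 ?A"
          unfolding iso_profile_def by (rule INF_lower) simp
        also have "outer_minkowski M1 ?A \<le> J r" using r by (rule minkowski)
        finally show ?thesis by (simp add: mult_left_mono)
      qed simp
    qed
  qed
  also have "\<dots> = Phi M2 (emeasure M1 E) * (\<integral>\<^sup>+r. J r \<partial>lborel)"
    by (rule nn_integral_cmult) simp
  also have "\<dots> \<le> Phi M2 (emeasure M1 E) * (\<integral>\<^sup>+x. grad_modulus g x \<partial>M1)"
    using Jint by (rule mult_left_mono) simp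
  finally show ?thesis .
qed

text \<open>The positive and negative parts of \<open>f\<close> each satisfy the one-signed bound,
  and their increments never exceed those of \<open>f\<close>; hence the factor
  \<open>2\<close>.\<close>

lemma set_nn_integral_abs_le_Phi_grad:
  fixes M1 :: "'a::metric_space measure" and M2 :: "'b::metric_space measure"
  assumes iso: "isoperimetric_space M1" "isoperimetric_space M2"
    and eq: "emeasure M1 (space M1) = emeasure M2 (space M2)"
    and le: "\<And>t. t < emeasure M1 (space M1) \<Longrightarrow> iso_profile M2 t \<le> iso_profile M1 t"
    and f: "f \<in> Lip"
    and half: "emeasure M1 {x. 0 < f x} \<le> emeasure M1 (space M1) / 2"
      "emeasure M1 {x. f x < 0} \<le> emeasure M1 (space M1) / 2"
    and less: "emeasure M1 {x. 0 < f x} < emeasure M1 (space M1)"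
      "emeasure M1 {x. f x < 0} < emeasure M1 (space M1)"
    and E: "E \<in> sets M1"
  shows "(\<integral>\<^sup>+x\<in>E. ennreal \<bar>f x\<bar> \<partial>M1) \<le> 2 * Phi M2 (emeasure M1 E) * (\<integral>\<^sup>+x. grad_modulus f x \<partial>M1)"
proof -
  interpret M1: isoperimetric_space M1 by fact
  note [measurable_cong] = M1.borel_measure
  note [measurable] = E
  let ?G = "\<integral>\<^sup>+x. grad_modulus f x \<partial>M1"
  let ?P = "Phi M2 (emeasure M1 E)"
  obtain K where K: "K-lipschitz_on UNIV f" using f by (auto simp: Lip_def)
  then have "continuous_on UNIV f" by (rule lipschitz_on_continuous_on)
  then have [measurable]: "f \<in> borel_measurable borel" by (rule borel_measurable_continuous_onI)
  have part: "(\<integral>\<^sup>+x\<in>E. ennreal (g x) \<partial>M1) \<le> ?P * ?G"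
    if g: "\<And>x y. \<bar>g x - g y\<bar> \<le> \<bar>f x - f y\<bar>" "\<And>x. 0 \<le> g x"
      and sets: "{x. 0 < g x} = {x. 0 < f x} \<or> {x. 0 < g x} = {x. f x < 0}" for g
  proof -
    have "K-lipschitz_on UNIV g"
      using K by (auto simp: lipschitz_on_def dist_real_def intro: order_trans[OF g(1)])
    then have "(\<integral>\<^sup>+x\<in>E. ennreal (g x) \<partial>M1) \<le> ?P * (\<integral>\<^sup>+x. grad_modulus g x \<partial>M1)"
      using sets half less g(2) E by (intro set_nn_integral_le_Phi_grad iso eq le) auto
    also have "\<dots> \<le> ?P * ?G"
      by (intro mult_left_mono nn_integral_mono grad_modulus_mono g) simp
    finally show ?thesis .
  qed
  have "(\<integral>\<^sup>+x\<in>E. ennreal \<bar>f x\<bar> \<partial>M1)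
      = (\<integral>\<^sup>+x. ennreal (max (f x) 0) * indicator E x + ennreal (max (- f x) 0) * indicator E x \<partial>M1)"
    by (intro nn_integral_cong) (auto simp: indicator_def max_def)
  also have "\<dots> = (\<integral>\<^sup>+x\<in>E. ennreal (max (f x) 0) \<partial>M1) + (\<integral>\<^sup>+x\<in>E. ennreal (max (- f x) 0) \<partial>M1)"
    by (rule nn_integral_add) auto
  also have "\<dots> \<le> ?P * ?G + ?P * ?G"
    by (intro add_mono part) (auto simp: max_def less_max_iff_disj)
  also have "\<dots> = 2 * ?P * ?G"
    by (metis mult.assoc mult_2)
  finally show ?thesis .
qed

section \<open>Medians and functions of mean zero\<close>

lemma exists_median:
  fixes f :: "'a \<Rightarrow> real"
  assumes "finite_measure M" and [measurable]: "f \<in> borel_measurable M" and "0 < measure M (space M)"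
  obtains m where "measure M {x \<in> space M. m < f x} \<le> measure M (space M) / 2"
    "measure M {x \<in> space M. f x < m} \<le> measure M (space M) / 2"
proof -
  interpret finite_measure M by fact
  define F where "F = (\<lambda>r. measure M {x \<in> space M. r < f x})"
  let ?L = "measure M (space M)"
  have anti: "F s \<le> F r" if "r \<le> s" for r s
    unfolding F_def using that by (intro finite_measure_mono) auto
  \<comment> \<open>The median will be the infimum of \<open>S\<close>. The tail measure
    \<open>F\<close> tends to \<open>0\<close> at infinity, so \<open>S\<close> is nonempty, and to
    the full mass at minus infinity, so \<open>S\<close> is bounded below.\<close>
  define S where "S = {r. F r \<le> ?L / 2}"
  have "(\<lambda>n. F (real n)) \<longlonglongrightarrow> measure M (\<Inter>n. {x \<in> space M. real n < f x})"
    unfolding F_def by (intro finite_Lim_measure_decseq) (auto simp: decseq_def)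
  also have "(\<Inter>n. {x \<in> space M. real n < f x}) = {}"
    by auto (meson not_less real_arch_simple)
  finally have "eventually (\<lambda>n. F (real n) < ?L / 2) sequentially"
    using assms(3) by (intro order_tendstoD) auto
  then obtain n where "F (real n) < ?L / 2" by (auto simp: eventually_sequentially)
  then have ne: "S \<noteq> {}" by (auto simp: S_def intro: less_imp_le)
  have "(\<lambda>n. F (- real n)) \<longlonglongrightarrow> measure M (\<Union>n. {x \<in> space M. - real n < f x})"
    unfolding F_def by (intro finite_Lim_measure_incseq) (auto simp: incseq_def)
  also have "(\<Union>n. {x \<in> space M. - real n < f x}) = space M"
    by auto (metis minus_less_iff reals_Archimedean2)
  finally have "eventually (\<lambda>n. ?L / 2 < F (- real n)) sequentially"
    using assms(3) by (intro order_tendstoD) auto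
  then obtain k where k: "?L / 2 < F (- real k)" by (auto simp: eventually_sequentially)
  have bdd: "bdd_below S"
  proof (rule bdd_belowI)
    fix r assume "r \<in> S"
    then show "- real k \<le> r" using k anti[of r "- real k"] by (auto simp: S_def intro: ccontr)
  qed
  define m where "m = Inf S"
  have above: "F r \<le> ?L / 2" if mr: "m < r" for r
  proof -
    obtain s where "s \<in> S" "s < r" using mr cInf_less_iff[OF ne bdd, of r] by (auto simp: m_def)
    then show ?thesis using anti[of s r] by (auto simp: S_def)
  qed
  have below: "?L / 2 < F r" if "r < m" for r
    using that bdd cInf_lower[of r S] by (force simp: m_def S_def)
  have dec: "1 / real (Suc j) \<le> 1 / real (Suc i)" if "i \<le> j" for i j
    using that by (intro frac_le) auto
  \<comment> \<open>\<open>F\<close> is controlled only strictly above and strictly below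
    \<open>m\<close>, so both estimates pass to the limit from the levels
    \<open>m + 1 / (n + 1)\<close> and \<open>m - 1 / (n + 1)\<close>.\<close>
  show thesis
  proof
    have "(\<lambda>n. F (m + 1 / real (Suc n))) \<longlonglongrightarrow> measure M (\<Union>n. {x \<in> space M. m + 1 / real (Suc n) < f x})"
      unfolding F_def by (intro finite_Lim_measure_incseq)
        (auto simp: incseq_def simp del: of_nat_Suc dest!: dec)
    also have "(\<Union>n. {x \<in> space M. m + 1 / real (Suc n) < f x}) = {x \<in> space M. m < f x}"
    proof safe
      fix x assume "x \<in> space M" "m < f x"
      then obtain n where "inverse (real (Suc n)) < f x - m" using reals_Archimedean[of "f x - m"] by auto
      then show "x \<in> (\<Union>n. {x \<in> space M. m + 1 / real (Suc n) < f x})"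
        using \<open>x \<in> space M\<close> by (auto simp: inverse_eq_divide algebra_simps intro!: exI[of _ n])
    next
      fix x n assume "m + 1 / real (Suc n) < f x"
      moreover have "0 < 1 / real (Suc n)" by simp
      ultimately show "m < f x" by linarith
    qed
    finally show "measure M {x \<in> space M. m < f x} \<le> ?L / 2"
      by (rule LIMSEQ_le_const2) (intro exI allI impI above, simp)
  next
    have "(\<lambda>n. measure M {x \<in> space M. f x < m - 1 / real (Suc n)})
        \<longlonglongrightarrow> measure M (\<Union>n. {x \<in> space M. f x < m - 1 / real (Suc n)})"
      by (intro finite_Lim_measure_incseq)
        (auto simp: incseq_def simp del: of_nat_Suc dest!: dec)
    also have "(\<Union>n. {x \<in> space M. f x < m - 1 / real (Suc n)}) = {x \<in> space M. f x < m}"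
    proof safe
      fix x assume "x \<in> space M" "f x < m"
      then obtain n where "inverse (real (Suc n)) < m - f x" using reals_Archimedean[of "m - f x"] by auto
      then show "x \<in> (\<Union>n. {x \<in> space M. f x < m - 1 / real (Suc n)})"
        using \<open>x \<in> space M\<close> by (auto simp: inverse_eq_divide algebra_simps intro!: exI[of _ n])
    next
      fix x n assume "f x < m - 1 / real (Suc n)"
      moreover have "0 < 1 / real (Suc n)" by simp
      ultimately show "f x < m" by linarith
    qed
    finally show "measure M {x \<in> space M. f x < m} \<le> ?L / 2"
    proof (rule LIMSEQ_le_const2, intro exI allI impI)
      fix n :: nat
      let ?c = "m - 1 / real (Suc n)"
      have "measure M {x \<in> space M. f x < ?c} + F ?c
          = measure M ({x \<in> space M. f x < ?c} \<union> {x \<in> space M. ?c < f x})"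
        unfolding F_def by (intro finite_measure_Union[symmetric]) auto
      also have "\<dots> \<le> ?L" by (rule bounded_measure)
      finally show "measure M {x \<in> space M. f x < ?c} \<le> ?L / 2"
        using below[of ?c] by simp
    qed
  qed
qed

text \<open>If \<open>m\<close> is a median of \<open>f\<close>, then integrating \<open>f - m\<close> gives \<open>\<bar>m\<bar> * L \<le> 2 * \<Phi>(L) * G\<close>, that is,
  \<open>\<bar>m\<bar> * I(L/2) \<le> G\<close>, and \<open>\<mu>(E) \<le> 2 * \<Phi>(\<mu>(E)) * I(L/2)\<close> for every \<open>E\<close>.\<close>

lemma set_nn_integral_mean_zero_le_Phi_grad:
  fixes M1 :: "'a::metric_space measure" and M2 :: "'b::metric_space measure"
  assumes iso: "isoperimetric_space M1" "isoperimetric_space M2"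
    and eq: "emeasure M1 (space M1) = emeasure M2 (space M2)"
    and le: "\<And>t. t < emeasure M1 (space M1) \<Longrightarrow> iso_profile M2 t \<le> iso_profile M1 t"
    and f: "f \<in> Lip" and fin: "0 < emeasure M1 (space M1)" "emeasure M1 (space M1) < \<infinity>"
    and int: "integrable M1 f" "integral\<^sup>L M1 f = 0"
    and E: "E \<in> sets M1"
  shows "(\<integral>\<^sup>+x\<in>E. ennreal \<bar>f x\<bar> \<partial>M1) \<le> 4 * Phi M2 (emeasure M1 E) * (\<integral>\<^sup>+x. grad_modulus f x \<partial>M1)"
proof -
  interpret M1: isoperimetric_space M1 by fact
  interpret M2: isoperimetric_space M2 by fact
  interpret finite_measure M1 using fin by (intro finite_measureI) auto
  note [measurable_cong] = M1.borel_measure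
  note [measurable] = E
  have space: "space M1 = UNIV" using sets_eq_imp_space_eq[OF M1.borel_measure] by simp
  let ?L = "emeasure M1 (space M1)"
  let ?G = "\<integral>\<^sup>+x. grad_modulus f x \<partial>M1"
  let ?i = "iso_profile M2 (?L / 2)"
  let ?P = "Phi M2 (emeasure M1 E)"
  have [measurable]: "f \<in> borel_measurable M1" using int by simp
  have "0 < measure M1 (space M1)" using fin by (simp add: emeasure_eq_measure)
  then obtain m where m: "measure M1 {x \<in> space M1. m < f x} \<le> measure M1 (space M1) / 2"
    "measure M1 {x \<in> space M1. f x < m} \<le> measure M1 (space M1) / 2"
    using exists_median finite_measure_axioms \<open>f \<in> borel_measurable M1\<close> by blast
  define g where "g = (\<lambda>x. f x - m)"
  have half: "emeasure M1 {x. 0 < g x} \<le> ?L / 2" "emeasure M1 {x. g x < 0} \<le> ?L / 2"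
    using m by (auto simp: g_def space emeasure_eq_measure ennreal_divide_numeral intro!: ennreal_leI)
  have two_half: "2 * (?L / 2) = ?L"
    unfolding ennreal_times_divide mult.commute[of 2] by (rule ennreal_mult_divide_eq) simp_all
  note L2 = M1.half_less[OF fin]
  have "g \<in> Lip" using f by (auto simp: Lip_def g_def lipschitz_on_def dist_real_def)
  then have "(\<integral>\<^sup>+x\<in>E. ennreal \<bar>g x\<bar> \<partial>M1) \<le> 2 * Phi M2 (emeasure M1 E) * (\<integral>\<^sup>+x. grad_modulus g x \<partial>M1)"
    if "E \<in> sets M1" for E
    using half L2 that by (intro set_nn_integral_abs_le_Phi_grad iso eq le) auto
  moreover have "(\<integral>\<^sup>+x. grad_modulus g x \<partial>M1) \<le> ?G"
    by (intro nn_integral_mono grad_modulus_mono) (auto simp: g_def)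
  ultimately have gE: "(\<integral>\<^sup>+x\<in>E. ennreal \<bar>g x\<bar> \<partial>M1) \<le> 2 * Phi M2 (emeasure M1 E) * ?G"
    if "E \<in> sets M1" for E
    using that by (meson mult_left_mono order_trans zero_le)
  \<comment> \<open>Mean zero enters here: \<open>g\<close> integrates to \<open>- m * L\<close>.
    Multiplying by the profile at \<open>L / 2\<close> turns \<open>Phi\<close> at \<open>L\<close>
    into \<open>L / 2\<close>.\<close>
  have "?L * (ennreal \<bar>m\<bar> * ?i) \<le> ?L * ?G"
  proof -
    have "ennreal \<bar>m\<bar> * ?L = ennreal (norm (integral\<^sup>L M1 g))"
      using int by (simp add: g_def emeasure_eq_measure ennreal_mult abs_mult mult.commute)
    also have "\<dots> \<le> (\<integral>\<^sup>+x. norm (g x) \<partial>M1)"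
      using int by (intro integral_norm_bound_ennreal) (simp add: g_def)
    also have "\<dots> = (\<integral>\<^sup>+x\<in>space M1. ennreal \<bar>g x\<bar> \<partial>M1)"
      by (intro nn_integral_cong) simp
    also have "\<dots> \<le> 2 * Phi M2 ?L * ?G" by (rule gE) simp
    finally have "ennreal \<bar>m\<bar> * ?L * ?i \<le> 2 * Phi M2 ?L * ?G * ?i" by (rule mult_right_mono) simp
    also have "\<dots> = 2 * (Phi M2 ?L * ?i) * ?G" by (simp add: ac_simps)
    also have "\<dots> \<le> 2 * (?L / 2) * ?G"
      using M2.Phi_space_mult_profile fin by (intro mult_left_mono mult_right_mono) (auto simp: eq)
    also note two_half
    finally show ?thesis by (simp add: ac_simps)
  qed
  then have mi: "ennreal \<bar>m\<bar> * ?i \<le> ?G"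
    using fin by (subst (asm) ennreal_mult_le_mult_iff) auto
  have "emeasure M1 E \<le> ?L" by (rule emeasure_space)
  \<comment> \<open>The doubled minimum has the shape of the product bound with
    \<open>u = L / 2\<close>, its largest admissible argument.\<close>
  then have "emeasure M1 E \<le> 2 * min (emeasure M1 E) (?L / 2)"
    using two_half by (auto simp: min_def mult_2)
  also have "\<dots> \<le> 2 * (?P * ?i)"
    using L2 \<open>emeasure M1 E \<le> ?L\<close> by (intro mult_left_mono M2.min_le_Phi_mult_profile) (auto simp: eq)
  finally have "ennreal \<bar>m\<bar> * emeasure M1 E \<le> ennreal \<bar>m\<bar> * (2 * (?P * ?i))"
    by (rule mult_left_mono) simp
  also have "\<dots> = 2 * ?P * (ennreal \<bar>m\<bar> * ?i)" by (simp add: ac_simps)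
  also have "\<dots> \<le> 2 * ?P * ?G" using mi by (rule mult_left_mono) simp
  finally have mE: "ennreal \<bar>m\<bar> * emeasure M1 E \<le> 2 * ?P * ?G" .
  have "(\<integral>\<^sup>+x\<in>E. ennreal \<bar>f x\<bar> \<partial>M1)
      \<le> (\<integral>\<^sup>+x. ennreal \<bar>g x\<bar> * indicator E x + ennreal \<bar>m\<bar> * indicator E x \<partial>M1)"
    by (intro nn_integral_mono) (auto simp: g_def indicator_def ennreal_plus[symmetric] intro!: ennreal_leI simp del: ennreal_plus)
  also have "\<dots> = (\<integral>\<^sup>+x\<in>E. ennreal \<bar>g x\<bar> \<partial>M1) + ennreal \<bar>m\<bar> * emeasure M1 E"
    by (subst nn_integral_add) (auto simp: g_def nn_integral_cmult)
  also have "\<dots> \<le> 2 * ?P * ?G + 2 * ?P * ?G" by (intro add_mono gE mE E)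
  \<comment> \<open>One copy comes from \<open>g\<close> and one from the constant \<open>m\<close>;
    this is the origin of the constant \<open>4\<close>.\<close>
  also have "\<dots> = (2 + 2) * ?P * ?G" by (simp only: distrib_right)
  finally show ?thesis by simp
qed

text \<open>Complements in a finite space turn the lower bounds in the definition of a median into
  the upper bounds that the local estimate takes.\<close>

lemma median_zero_half:
  assumes "finite_measure M" "is_median M f 0"
  shows "emeasure M {x \<in> space M. 0 < f x} \<le> emeasure M (space M) / 2"
    "emeasure M {x \<in> space M. f x < 0} \<le> emeasure M (space M) / 2"
proof -
  interpret finite_measure M by fact
  have [measurable]: "f \<in> borel_measurable M" using assms by (auto simp: is_median_def)
  have *: "measure M {x \<in> space M. 0 < f x} = measure M (space M) - measure M {x \<in> space M. f x \<le> 0}"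
    "measure M {x \<in> space M. f x < 0} = measure M (space M) - measure M {x \<in> space M. 0 \<le> f x}"
    by (subst finite_measure_compl[symmetric]; auto intro!: arg_cong[where f = "measure M"])+
  show "emeasure M {x \<in> space M. 0 < f x} \<le> emeasure M (space M) / 2"
    "emeasure M {x \<in> space M. f x < 0} \<le> emeasure M (space M) / 2"
    using assms(2) unfolding is_median_def emeasure_eq_measure
    by (auto simp: * ennreal_divide_numeral ennreal_le_iff intro!: ennreal_leI)
qed

section \<open>Interpolation\<close>

text \<open>Choosing \<open>s = sqrt (N * G / A)\<close> in \<open>\<integral>\<bar>f\<bar> \<le> s * A + c * N * G / s\<close>, where the first term
  comes from \<open>{1 / w \<le> s}\<close> and the second one from \<open>{1 / w > s}\<close>. If \<open>N * G = 0\<close> then letting \<open>s\<close>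
  tend to \<open>0\<close> in the second estimate alone gives \<open>f = 0\<close>.\<close>

lemma L1_norm_interpolation:
  fixes f w :: "'a \<Rightarrow> real" and c :: real
  assumes [measurable]: "f \<in> borel_measurable M"
    and wpos: "AE x in M. 0 < w x"
    and W: "(\<lambda>x. 1 / w x) \<in> marcinkiewicz_space \<Phi> M"
    and c: "0 \<le> c"
    and bound: "\<And>E. E \<in> sets M \<Longrightarrow> (\<integral>\<^sup>+x\<in>E. ennreal \<bar>f x\<bar> \<partial>M) \<le> ennreal c * \<Phi> (emeasure M E) * G"
  shows "L1_norm M f \<le> ennreal (1 + c) * ennreal_sqrt (marcinkiewicz_norm \<Phi> M (\<lambda>x. 1 / w x))
    * ennreal_sqrt G * ennreal_sqrt (L1_norm M (\<lambda>x. w x * f x))"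
proof -
  define N where "N = marcinkiewicz_norm \<Phi> M (\<lambda>x. 1 / w x)"
  define A where "A = L1_norm M (\<lambda>x. w x * f x)"
  have Nfin: "N < \<infinity>" and [measurable]: "(\<lambda>x. 1 / w x) \<in> borel_measurable M"
    using W by (auto simp: N_def marcinkiewicz_space_def)
  \<comment> \<open>Since \<open>1 / 0 = 0\<close>, the double reciprocal equals \<open>w\<close>
    everywhere, so \<open>w\<close> inherits measurability from \<open>1 / w\<close>.\<close>
  have "(\<lambda>x. 1 / (1 / w x)) \<in> borel_measurable M" by measurable
  then have [measurable]: "w \<in> borel_measurable M" by simp
  define E where "E = (\<lambda>s. {x \<in> space M. s < \<bar>1 / w x\<bar>})"
  have E [measurable]: "E s \<in> sets M" for s unfolding E_def by measurable
  have large: "(\<integral>\<^sup>+x\<in>E s. ennreal \<bar>f x\<bar> \<partial>M) \<le> ennreal c * (N / ennreal s) * G" if s: "0 < s" for s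
  proof -
    have "ennreal s * \<Phi> (emeasure M (E s)) \<le> N"
      unfolding N_def marcinkiewicz_norm_def E_def using s by (intro SUP_upper) auto
    then have "(ennreal s * \<Phi> (emeasure M (E s))) / ennreal s \<le> N / ennreal s"
      by (rule divide_right_mono_ennreal)
    then have "\<Phi> (emeasure M (E s)) \<le> N / ennreal s"
      using s by (simp add: mult.commute[of "ennreal s"] ennreal_mult_divide_eq)
    then have "ennreal c * \<Phi> (emeasure M (E s)) * G \<le> ennreal c * (N / ennreal s) * G"
      by (intro mult_mono) auto
    then show ?thesis using bound[OF E] by (rule order_trans[rotated])
  qed
  \<comment> \<open>In \<open>ennreal\<close> a zero factor times an infinite one is
    \<open>0\<close>, so whenever a factor on the right vanishes, \<open>f\<close> itself has to be
    shown zero almost everywhere.\<close>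
  consider "N * G = 0" | "A = 0" | "N \<noteq> 0" "G \<noteq> 0" "A \<noteq> 0" "G = \<infinity> \<or> A = \<infinity>"
    | "N \<noteq> 0" "G \<noteq> 0" "A \<noteq> 0" "G < \<infinity>" "A < \<infinity>"
    by (metis infinity_ennreal_def less_top mult_eq_0_iff)
  then have "L1_norm M f \<le> ennreal (1 + c) * ennreal_sqrt N * ennreal_sqrt G * ennreal_sqrt A"
  proof cases
    case 1
    have "AE x in M. ennreal \<bar>f x\<bar> * indicator (E (1 / real (Suc n))) x = 0" for n
    proof -
      have "ennreal c * (N / ennreal (1 / real (Suc n))) * G = 0" using 1 by auto
      then have "(\<integral>\<^sup>+x\<in>E (1 / real (Suc n)). ennreal \<bar>f x\<bar> \<partial>M) = 0"
        using large[of "1 / real (Suc n)"] by (metis le_zero_eq of_nat_0_less_iff zero_less_Suc zero_less_divide_1_iff)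
      then show ?thesis by (subst (asm) nn_integral_0_iff_AE) auto
    qed
    then have "AE x in M. \<forall>n. ennreal \<bar>f x\<bar> * indicator (E (1 / real (Suc n))) x = 0"
      by (subst AE_all_countable) blast
    with wpos AE_space[of M] have "AE x in M. ennreal \<bar>f x\<bar> = 0"
    proof eventually_elim
      case x: (elim x)
      obtain n where "inverse (real (Suc n)) < 1 / w x"
        using reals_Archimedean[of "1 / w x"] x by auto
      then have "x \<in> E (1 / real (Suc n))" using x by (simp add: E_def inverse_eq_divide)
      then show ?case using spec[OF x(3), of n] by simp
    qed
    then have "L1_norm M f = 0" unfolding L1_norm_def by (subst nn_integral_0_iff_AE) auto
    then show ?thesis by simp
  next
    case 2
    then have "AE x in M. ennreal \<bar>w x * f x\<bar> = 0"
      unfolding A_def L1_norm_def by (subst (asm) nn_integral_0_iff_AE) auto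
    with wpos have "AE x in M. ennreal \<bar>f x\<bar> = 0" by eventually_elim (auto simp: abs_mult)
    then have "L1_norm M f = 0" unfolding L1_norm_def by (subst nn_integral_0_iff_AE) auto
    then show ?thesis by simp
  next
    case 3
    \<comment> \<open>All factors are nonzero and one is infinite, so the right side is
      infinite.\<close>
    have pos: "ennreal_sqrt z \<noteq> 0" if "z \<noteq> 0" for z
      using that by (cases z) (auto simp: ennreal_sqrt_def)
    have "ennreal (1 + c) \<noteq> 0" using c by auto
    with 3 pos have "ennreal (1 + c) * ennreal_sqrt N * ennreal_sqrt G * ennreal_sqrt A = top"
      by (auto simp: ennreal_mult_eq_top_iff ennreal_sqrt_def)
    then show ?thesis by simp
  next
    case 4
    obtain n where n: "N = ennreal n" "0 < n" using Nfin 4 by (cases N) (auto simp: less_le)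
    obtain g where g: "G = ennreal g" "0 < g" using 4 by (cases G) (auto simp: less_le)
    obtain a where a: "A = ennreal a" "0 < a" using 4 by (cases A) (auto simp: less_le)
    define s where "s = sqrt n * sqrt g / sqrt a"
    have s: "0 < s" using n g a by (simp add: s_def)
    have "L1_norm M f \<le> (\<integral>\<^sup>+x. ennreal s * ennreal \<bar>w x * f x\<bar> + ennreal \<bar>f x\<bar> * indicator (E s) x \<partial>M)"
      unfolding L1_norm_def
    proof (rule nn_integral_mono_AE)
      from wpos AE_space[of M]
      show "AE x in M. ennreal \<bar>f x\<bar> \<le> ennreal s * ennreal \<bar>w x * f x\<bar> + ennreal \<bar>f x\<bar> * indicator (E s) x"
      proof eventually_elim
        case x: (elim x)
        show ?case
        proof (cases "x \<in> E s")
          case False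
          then have "1 \<le> s * w x" using x by (simp add: E_def field_simps)
          then have "1 * \<bar>f x\<bar> \<le> (s * w x) * \<bar>f x\<bar>" by (rule mult_right_mono) simp
          then have "\<bar>f x\<bar> \<le> s * \<bar>w x * f x\<bar>" using x by (simp add: abs_mult)
          then show ?thesis using s False by (simp add: ennreal_mult'[symmetric] ennreal_leI)
        qed simp
      qed
    qed
    also have "\<dots> = ennreal s * A + (\<integral>\<^sup>+x\<in>E s. ennreal \<bar>f x\<bar> \<partial>M)"
      by (subst nn_integral_add) (auto simp: nn_integral_cmult A_def L1_norm_def)
    also have "\<dots> \<le> ennreal s * A + ennreal c * (N / ennreal s) * G"
      by (intro add_left_mono large s)
    also have "\<dots> = ennreal (s * a + c * (n / s) * g)"
      using s n g a c by (simp add: divide_ennreal ennreal_mult[symmetric] ennreal_plus[symmetric] del: ennreal_plus)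
    \<comment> \<open>The choice of \<open>s\<close> balances the terms: \<open>s * a\<close> and
      \<open>n * g / s\<close> both equal \<open>sqrt (n * g * a)\<close>, whence the factor
      \<open>1 + c\<close>.\<close>
    also have "s * a + c * (n / s) * g = (1 + c) * sqrt n * sqrt g * sqrt a"
    proof -
      have "s * a = sqrt n * sqrt g * (a / sqrt a)" by (simp add: s_def)
      also have "a / sqrt a = sqrt a" using a by (simp add: real_div_sqrt)
      finally have 1: "s * a = sqrt n * sqrt g * sqrt a" .
      have "n / s * g = (n / sqrt n) * (g / sqrt g) * sqrt a" by (simp add: s_def)
      also have "\<dots> = sqrt n * sqrt g * sqrt a" using n g by (simp add: real_div_sqrt)
      finally have 2: "n / s * g = sqrt n * sqrt g * sqrt a" .
      show ?thesis unfolding mult.assoc[of c] 1 2 by (simp add: algebra_simps)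
    qed
    also have "ennreal ((1 + c) * sqrt n * sqrt g * sqrt a)
        = ennreal (1 + c) * ennreal_sqrt N * ennreal_sqrt G * ennreal_sqrt A"
      using n g a c by (simp add: ennreal_mult ennreal_sqrt_def)
    finally show ?thesis .
  qed
  then show ?thesis by (simp only: N_def A_def)
qed

section \<open>Application to the admissible functions\<close>

theorem mainTheorem8:
  fixes M1 :: "'a::metric_space measure" and M2 :: "'b::metric_space measure"
  assumes "isoperimetric_space M1" and "isoperimetric_space M2"
    and "emeasure M1 (space M1) = emeasure M2 (space M2)"
    and "\<And>t. t < emeasure M1 (space M1) \<Longrightarrow> iso_profile M2 t \<le> iso_profile M1 t"
  shows "\<exists>C::real. \<forall>w :: 'a \<Rightarrow> real.
    (\<forall>x. 0 \<le> w x) \<longrightarrow> (AE x in M1. 0 < w x) \<longrightarrow>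
    (\<lambda>x. 1 / w x) \<in> marcinkiewicz_space (Phi M2) M1 \<longrightarrow>
    (\<forall>f :: 'a \<Rightarrow> real.
       (emeasure M1 (space M1) < \<infinity> \<and> f \<in> Lip \<and>
          (is_median M1 f 0 \<or> integrable M1 f \<and> integral\<^sup>L M1 f = 0)) \<or>
       (emeasure M1 (space M1) = \<infinity> \<and> f \<in> Lip0) \<longrightarrow>
       L1_norm M1 f \<le>
         ennreal C * ennreal_sqrt (marcinkiewicz_norm (Phi M2) M1 (\<lambda>x. 1 / w x))
           * ennreal_sqrt (\<integral>\<^sup>+x. grad_modulus f x \<partial>M1)
           * ennreal_sqrt (L1_norm M1 (\<lambda>x. w x * f x)))"
proof (intro exI allI impI)
  fix w f :: "'a \<Rightarrow> real"
  assume w: "\<forall>x. 0 \<le> w x" "AE x in M1. 0 < w x"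
    "(\<lambda>x. 1 / w x) \<in> marcinkiewicz_space (Phi M2) M1"
    and f: "(emeasure M1 (space M1) < \<infinity> \<and> f \<in> Lip \<and>
          (is_median M1 f 0 \<or> integrable M1 f \<and> integral\<^sup>L M1 f = 0)) \<or>
       (emeasure M1 (space M1) = \<infinity> \<and> f \<in> Lip0)"
  interpret M1: isoperimetric_space M1 by fact
  have space: "space M1 = UNIV" using sets_eq_imp_space_eq[OF M1.borel_measure] by simp
  have Lip: "f \<in> Lip" using f by (auto simp: Lip0_def)
  then have "continuous_on UNIV f" by (auto simp: Lip_def intro: lipschitz_on_continuous_on)
  then have "f \<in> borel_measurable borel" by (rule borel_measurable_continuous_onI)
  then have fM [measurable]: "f \<in> borel_measurable M1"
    by (simp add: measurable_cong_sets[OF M1.borel_measure refl])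
  let ?L = "emeasure M1 (space M1)"
  let ?G = "\<integral>\<^sup>+x. grad_modulus f x \<partial>M1"
  have two_sided: "(\<integral>\<^sup>+x\<in>E. ennreal \<bar>f x\<bar> \<partial>M1) \<le> 4 * Phi M2 (emeasure M1 E) * ?G"
    if "E \<in> sets M1"
      "emeasure M1 {x. 0 < f x} \<le> ?L / 2" "emeasure M1 {x. f x < 0} \<le> ?L / 2"
      "emeasure M1 {x. 0 < f x} < ?L" "emeasure M1 {x. f x < 0} < ?L" for E
  proof -
    have "(\<integral>\<^sup>+x\<in>E. ennreal \<bar>f x\<bar> \<partial>M1) \<le> 2 * Phi M2 (emeasure M1 E) * ?G"
      using that Lip by (intro set_nn_integral_abs_le_Phi_grad assms)
    \<comment> \<open>Weakened so that all cases share the constant of the mean-zero case.\<close>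
    also have "\<dots> \<le> 4 * Phi M2 (emeasure M1 E) * ?G"
      by (intro mult_right_mono) auto
    finally show ?thesis .
  qed
  have bound: "(\<integral>\<^sup>+x\<in>E. ennreal \<bar>f x\<bar> \<partial>M1) \<le> ennreal 4 * Phi M2 (emeasure M1 E) * ?G"
    if E: "E \<in> sets M1" for E
  proof -
    \<comment> \<open>Zero mass is separated because \<open>L / 2 < L\<close> fails there.\<close>
    consider "?L = 0" | "0 < ?L" "?L < \<infinity>" "is_median M1 f 0"
      | "0 < ?L" "?L < \<infinity>" "integrable M1 f" "integral\<^sup>L M1 f = 0" | "?L = \<infinity>" "f \<in> Lip0"
      using f by (auto simp: zero_less_iff_neq_zero)
    then show ?thesis
    proof cases
      case 1
      then have "AE x in M1. ennreal \<bar>f x\<bar> * indicator E x = 0"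
        by (intro AE_I[where N = "space M1"]) auto
      then have "(\<integral>\<^sup>+x\<in>E. ennreal \<bar>f x\<bar> \<partial>M1) = 0"
        using E by (subst nn_integral_0_iff_AE) auto
      then show ?thesis by simp
    next
      case 2
      then have "finite_measure M1" by (intro finite_measureI) auto
      from median_zero_half[OF this 2(3)] M1.half_less[OF 2(1,2)] show ?thesis
        using two_sided[OF E] by (auto simp: space)
    next
      case 3
      then show ?thesis
        using set_nn_integral_mean_zero_le_Phi_grad[OF assms Lip 3 E] by simp
    next
      case 4
      \<comment> \<open>Compact support makes the sets where \<open>f\<close> is positive or
        negative finite in measure, hence strictly below the infinite mass; half of that mass is
        still infinite.\<close>
      then have "emeasure M1 (closure {x. f x \<noteq> 0}) < \<infinity>"
        by (intro M1.finite_on_compact) (simp add: Lip0_def)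
      moreover have "emeasure M1 A \<le> emeasure M1 (closure {x. f x \<noteq> 0})" if "A \<subseteq> {x. f x \<noteq> 0}" for A
        using that closure_subset[of "{x. f x \<noteq> 0}"]
        by (intro emeasure_mono) (auto simp: M1.borel_measure)
      ultimately have "emeasure M1 A < \<infinity>" if "A \<subseteq> {x. f x \<noteq> 0}" for A
        using that le_less_trans by blast
      then have "emeasure M1 {x. 0 < f x} < ?L" "emeasure M1 {x. f x < 0} < ?L"
        unfolding 4(1) by (metis (mono_tags, lifting) Collect_mono less_irrefl)+
      then show ?thesis using two_sided[OF E] 4(1) by (simp add: ennreal_top_divide)
    qed
  qed
  \<comment> \<open>The witness for \<open>C\<close>, left schematic by \<open>exI\<close>, is fixed
    here as \<open>1 + c\<close> with \<open>c = 4\<close>; it depends on neither the functions nor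
    the spaces.\<close>
  show "L1_norm M1 f \<le> ennreal (1 + 4) * ennreal_sqrt (marcinkiewicz_norm (Phi M2) M1 (\<lambda>x. 1 / w x))
      * ennreal_sqrt ?G * ennreal_sqrt (L1_norm M1 (\<lambda>x. w x * f x))"
    using w by (intro L1_norm_interpolation fM bound) auto
qed

end
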